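(* In Darboux coordinates $z_0=(q_0,p_0)^T$ and $z_h=(q_h,p_h)^T$, with $q_0,p_0,q_h,p_h\in\mathbb{R}^n$, consider the generalized symplectic Euler scheme $$z_h=z_0+hX_H(\bar{\mathbf z}),\qquad \bar{\mathbf z}=\tfrac12(z_0+z_h)+b(z_h-z_0),$$ with $b\in\mathbb{M}_{2n\times2n}(\mathbb{R})$ a Hamiltonian matrix. The Hamiltonian matrices $$b_A=\tfrac12\begin{pmatrix}-I&0\\0&I\end{pmatrix},\qquad b_B=\tfrac12\begin{pmatrix}I&0\\0&-I\end{pmatrix}$$ correspond to the symplectic Euler $A$ scheme and the symplectic Euler $B$ scheme, respectively.
   Context: In Darboux coordinates $z=(q,p)$ the symplectic form is $\omega=\sum_i dp_i\wedge dq_i$, $J=\begin{pmatrix}0&I\\-I&0\end{pmatrix}$, and the Hamiltonian vector field of $H$ is $X_H=(\partial H/\partial p,-\partial H/\partial q)$. A matrix $b$ is Hamiltonian if $b^TJ+Jb=0$. The symplectic Euler $A$ scheme is $z_h=z_0+hX_H(q_0,p_h)$, and the symplectic Euler $B$ scheme is $z_h=z_0+hX_H(q_h,p_0)$. The number $h$ is the step size. *)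

theory Defs
  imports "HOL-Analysis.Analysis"
begin

text \<open>
  Phase space \<open>\<real>\<^sup>2\<^sup>n\<close> is \<open>real ^ ('n + 'n)\<close> with \<open>n = CARD('n)\<close>: the indices \<open>Inl i\<close> carry the
  coordinates \<open>q\<^sub>i\<close>, the indices \<open>Inr i\<close> the coordinates \<open>p\<^sub>i\<close>.
\<close>

definition darboux :: "real ^ 'n \<Rightarrow> real ^ 'n \<Rightarrow> real ^ ('n::finite + 'n)" where
  "darboux q p = (\<chi> k. case k of Inl i \<Rightarrow> q $ i | Inr i \<Rightarrow> p $ i)"

text \<open>The block matrix with rows \<open>(A, B)\<close> and \<open>(C, D)\<close>.\<close>

definition block ::
  "real ^ 'n ^ 'n \<Rightarrow> real ^ 'n ^ 'n \<Rightarrow> real ^ 'n ^ 'n \<Rightarrow> real ^ 'n ^ 'n \<Rightarrow>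
    real ^ ('n::finite + 'n) ^ ('n + 'n)" where
  "block A B C D = (\<chi> k l. case k of
      Inl i \<Rightarrow> (case l of Inl j \<Rightarrow> A $ i $ j | Inr j \<Rightarrow> B $ i $ j)
    | Inr i \<Rightarrow> (case l of Inl j \<Rightarrow> C $ i $ j | Inr j \<Rightarrow> D $ i $ j))"

definition J :: "real ^ ('n::finite + 'n) ^ ('n + 'n)" where
  "J = block 0 (mat 1) (- mat 1) 0"

definition hamiltonian_matrix :: "real ^ ('n::finite + 'n) ^ ('n + 'n) \<Rightarrow> bool" where
  "hamiltonian_matrix b \<longleftrightarrow> transpose b ** J + J ** b = 0"

definition partial_deriv :: "(real ^ 'k \<Rightarrow> real) \<Rightarrow> 'k::finite \<Rightarrow> real ^ 'k \<Rightarrow> real" where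
  "partial_deriv f k z = deriv (\<lambda>t. f (z + t *\<^sub>R axis k 1)) 0"

definition hamiltonian_vf ::
  "(real ^ ('n::finite + 'n) \<Rightarrow> real) \<Rightarrow> real ^ ('n + 'n) \<Rightarrow> real ^ ('n + 'n)" where
  "hamiltonian_vf H z =
    darboux (\<chi> i. partial_deriv H (Inr i) z) (\<chi> i. - partial_deriv H (Inl i) z)"

text \<open>
  The schemes are implicit, so each is a relation between the current point and the next point:
  it holds when the latter solves the defining equation with step size \<open>h\<close>.
\<close>

definition generalized_symplectic_euler ::
  "real ^ ('n::finite + 'n) ^ ('n + 'n) \<Rightarrow> (real ^ ('n + 'n) \<Rightarrow> real) \<Rightarrow> real \<Rightarrow>
    real ^ ('n + 'n) \<Rightarrow> real ^ ('n + 'n) \<Rightarrow> bool" where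
  "generalized_symplectic_euler b H h z0 zh \<longleftrightarrow>
    zh = z0 + h *\<^sub>R hamiltonian_vf H ((1/2) *\<^sub>R (z0 + zh) + b *v (zh - z0))"

definition symplectic_euler_A ::
  "(real ^ ('n::finite + 'n) \<Rightarrow> real) \<Rightarrow> real \<Rightarrow>
    real ^ 'n \<Rightarrow> real ^ 'n \<Rightarrow> real ^ 'n \<Rightarrow> real ^ 'n \<Rightarrow> bool" where
  "symplectic_euler_A H h q0 p0 qh ph \<longleftrightarrow>
    darboux qh ph = darboux q0 p0 + h *\<^sub>R hamiltonian_vf H (darboux q0 ph)"

definition symplectic_euler_B ::
  "(real ^ ('n::finite + 'n) \<Rightarrow> real) \<Rightarrow> real \<Rightarrow>
    real ^ 'n \<Rightarrow> real ^ 'n \<Rightarrow> real ^ 'n \<Rightarrow> real ^ 'n \<Rightarrow> bool" where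
  "symplectic_euler_B H h q0 p0 qh ph \<longleftrightarrow>
    darboux qh ph = darboux q0 p0 + h *\<^sub>R hamiltonian_vf H (darboux qh p0)"

definition b_A :: "real ^ ('n::finite + 'n) ^ ('n + 'n)" where
  "b_A = (1/2) *\<^sub>R block (- mat 1) 0 0 (mat 1)"

definition b_B :: "real ^ ('n::finite + 'n) ^ ('n + 'n)" where
  "b_B = (1/2) *\<^sub>R block (mat 1) 0 0 (- mat 1)"

end

theory Submission
  imports Defs
begin

text \<open>Both schemes and the generalized scheme have the form
  \<open>zh = z0 + h *\<^sub>R hamiltonian_vf H z\<close>, so it is enough to compare the points
  \<open>z\<close> at which the vector field is evaluated. Adding half of a coordinate's increment
  to its midpoint gives the new value, subtracting it gives the old one; the signs in
  \<open>b_A\<close> and \<open>b_B\<close> make this choice separately for q and p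
  (\<open>midpoint_b_A\<close>, \<open>midpoint_b_B\<close>). Both matrices are Hamiltonian because
  the lower diagonal block is minus the transpose of the upper one
  (\<open>hamiltonian_matrix_block_diag\<close>).\<close>

lemma sum_sum_type:
  fixes f :: "'a::finite + 'b::finite \<Rightarrow> 'c::comm_monoid_add"
  shows "(\<Sum>k\<in>UNIV. f k) = (\<Sum>i\<in>UNIV. f (Inl i)) + (\<Sum>i\<in>UNIV. f (Inr i))"
  by (simp add: UNIV_Plus_UNIV[symmetric] sum.Plus comp_def del: UNIV_Plus_UNIV)

text \<open>The sum over the inner index splits by \<open>sum_sum_type\<close> into its q part and
  its p part, which yield the two summands of each block.\<close>

lemma block_matrix_mult:
  "block A B C D ** block A' B' C' D' =
    block (A ** A' + B ** C') (A ** B' + B ** D') (C ** A' + D ** C') (C ** B' + D ** D')"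
  by (simp add: block_def matrix_matrix_mult_def vec_eq_iff sum_sum_type split: sum.split)

lemma block_mult_darboux: "block A B C D *v darboux q p = darboux (A *v q + B *v p) (C *v q + D *v p)"
  by (simp add: block_def darboux_def matrix_vector_mult_def vec_eq_iff sum_sum_type split: sum.split)

lemma transpose_block:
  "transpose (block A B C D) = block (transpose A) (transpose C) (transpose B) (transpose D)"
  by (simp add: block_def transpose_def vec_eq_iff split: sum.split)

lemma block_add: "block A B C D + block A' B' C' D' = block (A + A') (B + B') (C + C') (D + D')"
  by (simp add: block_def vec_eq_iff split: sum.split)

lemma scaleR_block: "c *\<^sub>R block A B C D = block (c *\<^sub>R A) (c *\<^sub>R B) (c *\<^sub>R C) (c *\<^sub>R D)"
  by (simp add: block_def vec_eq_iff split: sum.split)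

lemma block_zero: "block 0 0 0 0 = 0"
  by (simp add: block_def vec_eq_iff split: sum.split)

lemma darboux_add: "darboux q p + darboux q' p' = darboux (q + q') (p + p')"
  by (simp add: darboux_def vec_eq_iff split: sum.split)

lemma darboux_diff: "darboux q p - darboux q' p' = darboux (q - q') (p - p')"
  by (simp add: darboux_def vec_eq_iff split: sum.split)

lemma scaleR_darboux: "c *\<^sub>R darboux q p = darboux (c *\<^sub>R q) (c *\<^sub>R p)"
  by (simp add: darboux_def vec_eq_iff split: sum.split)

lemma uminus_matrix_mult: "(- X) ** Y = - (X ** Y)" for X :: "'a::ring_1 ^ 'n ^ 'm"
  by (simp add: matrix_matrix_mult_def vec_eq_iff sum_negf)

lemma matrix_mult_uminus: "X ** (- Y) = - (X ** Y)" for X :: "'a::ring_1 ^ 'n ^ 'm"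
  by (simp add: matrix_matrix_mult_def vec_eq_iff sum_negf)

lemma uminus_matrix_vector_mult: "(- X) *v y = - (X *v y)" for X :: "'a::ring_1 ^ 'n ^ 'm"
  by (simp add: matrix_vector_mult_def vec_eq_iff sum_negf)

lemma transpose_uminus: "transpose (- X) = - transpose X" for X :: "'a::ring_1 ^ 'n ^ 'm"
  by (simp add: transpose_def vec_eq_iff)

lemma transpose_0: "transpose 0 = 0"
  by (simp add: transpose_def vec_eq_iff)

text \<open>For such a matrix \<open>b\<close>, the product \<open>transpose b ** J\<close> has
  off-diagonal blocks \<open>transpose A\<close> and \<open>A\<close>, while \<open>J ** b\<close>
  has their negatives.\<close>

lemma hamiltonian_matrix_block_diag: "hamiltonian_matrix (block A 0 0 (- transpose A))"
  by (simp add: hamiltonian_matrix_def J_def transpose_block block_matrix_mult block_add block_zero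
      uminus_matrix_mult matrix_mult_uminus transpose_uminus transpose_0)

lemma b_A_eq_block: "b_A = block (- ((1/2) *\<^sub>R mat 1)) 0 0 ((1/2) *\<^sub>R mat 1)"
  by (simp add: b_A_def scaleR_block)

lemma b_B_eq_block: "b_B = block ((1/2) *\<^sub>R mat 1) 0 0 (- ((1/2) *\<^sub>R mat 1))"
  by (simp add: b_B_def scaleR_block)

lemma hamiltonian_matrix_b_A: "hamiltonian_matrix b_A"
  \<comment> \<open>A multiple of the identity is symmetric, so minus its transpose is the opposite
    multiple, as the lower block requires.\<close>
  using hamiltonian_matrix_block_diag[of "- ((1/2) *\<^sub>R mat 1)"]
  by (simp add: b_A_eq_block transpose_uminus transpose_scalar)

lemma hamiltonian_matrix_b_B: "hamiltonian_matrix b_B"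
  using hamiltonian_matrix_block_diag[of "(1/2) *\<^sub>R mat 1"]
  by (simp add: b_B_eq_block transpose_scalar)

text \<open>Componentwise, (q0 + qh)/2 - (qh - q0)/2 = q0 and (p0 + ph)/2 + (ph - p0)/2 =
  ph.\<close>

lemma midpoint_b_A:
  "(1/2) *\<^sub>R (darboux q0 p0 + darboux qh ph) + b_A *v (darboux qh ph - darboux q0 p0) = darboux q0 ph"
  by (simp add: b_A_def scaleR_matrix_vector_assoc[symmetric] block_mult_darboux uminus_matrix_vector_mult
      darboux_add darboux_diff scaleR_darboux)
    (simp add: darboux_def vec_eq_iff field_simps split: sum.split)

text \<open>The signs are opposite to those of \<open>b_A\<close>, so q moves to its new value and p
  back to its old one.\<close>

lemma midpoint_b_B:
  "(1/2) *\<^sub>R (darboux q0 p0 + darboux qh ph) + b_B *v (darboux qh ph - darboux q0 p0) = darboux qh p0"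
  by (simp add: b_B_def scaleR_matrix_vector_assoc[symmetric] block_mult_darboux uminus_matrix_vector_mult
      darboux_add darboux_diff scaleR_darboux)
    (simp add: darboux_def vec_eq_iff field_simps split: sum.split)

theorem proposition4:
  fixes H :: "real ^ ('n::finite + 'n) \<Rightarrow> real"
    and h :: real
    and q0 p0 qh ph :: "real ^ 'n"
  assumes "H differentiable_on UNIV"
  shows "hamiltonian_matrix (b_A :: real ^ ('n + 'n) ^ ('n + 'n))
    \<and> hamiltonian_matrix (b_B :: real ^ ('n + 'n) ^ ('n + 'n))
    \<and> (generalized_symplectic_euler b_A H h (darboux q0 p0) (darboux qh ph)
          \<longleftrightarrow> symplectic_euler_A H h q0 p0 qh ph)
    \<and> (generalized_symplectic_euler b_B H h (darboux q0 p0) (darboux qh ph)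
          \<longleftrightarrow> symplectic_euler_B H h q0 p0 qh ph)"
  \<comment> \<open>Once the evaluation points are rewritten, the two sides of each equivalence are
    the same equation.\<close>
  unfolding generalized_symplectic_euler_def symplectic_euler_A_def symplectic_euler_B_def
    midpoint_b_A midpoint_b_B
  by (simp add: hamiltonian_matrix_b_A hamiltonian_matrix_b_B)

end
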